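(* Let $D$ be a VFD. (1) ${\rm Cl}_t(D)=\{0\}$. (2) Every atom of $D$ is a prime element. (3) If $D$ is a $t$-finite conductor domain, i.e., the intersection of each two nonzero principal ideals of $D$ is $t$-finite, then $D$ is a GCD-domain.
   Context: Let $D$ be an integral domain with quotient field $K$. An overring of $D$ is a subring of $K$ containing $D$. A nonzero nonunit $a\in D$ is a valuation element of $D$ if there is a valuation domain $V$ that is an overring of $D$ with $aV\cap D=aD$. $D$ is a VFD (valuation factorization domain) if every nonzero nonunit of $D$ is a finite product of valuation elements. For a nonzero fractional ideal $A$ let $A^{-1}=\{x\in K\mid xA\subseteq D\}$, $A_v=(A^{-1})^{-1}$ and $A_t=\bigcup\{I_v\mid I\subseteq A,\ I$ a nonzero finitely generated fractional ideal$\}$. $A$ is a $t$-ideal if $A_t=A$. A $t$-ideal $I$ is $t$-finite if $I=J_t$ for some nonzero finitely generated fractional ideal $J$. $A$ is $t$-invertible if $(AA^{-1})_t=D$. The $t$-invertible fractional $t$-ideals form an abelian group ${\rm T}(D)$ under $I*J=(IJ)_t$; the $t$-class group ${\rm Cl}_t(D)$ is the quotient of ${\rm T}(D)$ by the subgroup of nonzero principal fractional ideals. An atom is an irreducible element (a nonzero nonunit that is not a product of two nonunits). *)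

theory Defs
  imports
    "HOL-Computational_Algebra.Polynomial_Factorial"
    "HOL-Algebra.Coset"
begin

text \<open>
  The integral domain \<open>D\<close> is an arbitrary type \<open>'a\<close> of class \<^class>\<open>idom\<close>, and its quotient
  field \<open>K\<close> is \<open>'a fract\<close>, which is viewed as a \<open>D\<close>-module through \<^const>\<open>to_fract\<close>.
  Properties of \<open>D\<close> itself are predicates on \<open>TYPE('a)\<close>. Fractional ideals, overrings and the
  copy of \<open>D\<close> in \<open>K\<close> are subsets of \<open>'a fract\<close>.
\<close>

abbreviation base_ring :: "'a::idom fract set" where
  "base_ring \<equiv> range to_fract"

interpretation frac: module "\<lambda>(d::'a::idom) (x::'a fract). to_fract d * x"
  by unfold_locales (simp_all add: algebra_simps)

text \<open>The set \<open>x A\<close>.\<close>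

definition dilate :: "'a::idom fract \<Rightarrow> 'a fract set \<Rightarrow> 'a fract set" where
  "dilate x A = (\<lambda>y. x * y) ` A"


subsection \<open>Valuation elements\<close>

definition overring :: "'a::idom fract set \<Rightarrow> bool" where
  "overring V \<longleftrightarrow> base_ring \<subseteq> V \<and> (\<forall>x\<in>V. \<forall>y\<in>V. x - y \<in> V \<and> x * y \<in> V)"

text \<open>
  The quotient field of an overring of \<open>D\<close> is again \<open>K\<close>, so an overring is a valuation domain
  iff it contains \<open>x\<close> or \<open>1/x\<close> for every nonzero \<open>x\<close> in \<open>K\<close>. The case \<open>V = K\<close> is allowed.
\<close>

definition valuation_overring :: "'a::idom fract set \<Rightarrow> bool" where
  "valuation_overring V \<longleftrightarrow> overring V \<and> (\<forall>x. x \<noteq> 0 \<longrightarrow> x \<in> V \<or> inverse x \<in> V)"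

definition valuation_element :: "'a::idom \<Rightarrow> bool" where
  "valuation_element a \<longleftrightarrow> a \<noteq> 0 \<and> \<not> a dvd 1 \<and>
     (\<exists>V. valuation_overring V \<and>
        dilate (to_fract a) V \<inter> base_ring = dilate (to_fract a) base_ring)"

definition VFD :: "'a::idom itself \<Rightarrow> bool" where
  "VFD TYPE('a) \<longleftrightarrow>
     (\<forall>a::'a. a \<noteq> 0 \<and> \<not> a dvd 1 \<longrightarrow>
        (\<exists>xs. a = prod_list xs \<and> (\<forall>x\<in>set xs. valuation_element x)))"


subsection \<open>Fractional ideals, the \<open>v\<close>- and the \<open>t\<close>-operation\<close>

definition fractional_ideal :: "'a::idom fract set \<Rightarrow> bool" where
  "fractional_ideal A \<longleftrightarrow> frac.subspace A \<and> (\<exists>d. d \<noteq> 0 \<and> dilate (to_fract d) A \<subseteq> base_ring)"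

definition nonzero_fractional_ideal :: "'a::idom fract set \<Rightarrow> bool" where
  "nonzero_fractional_ideal A \<longleftrightarrow> fractional_ideal A \<and> A \<noteq> {0}"

definition finitely_generated :: "'a::idom fract set \<Rightarrow> bool" where
  "finitely_generated A \<longleftrightarrow> (\<exists>S. finite S \<and> A = frac.span S)"

definition ideal_prod :: "'a::idom fract set \<Rightarrow> 'a fract set \<Rightarrow> 'a fract set" where
  "ideal_prod A B = frac.span {x * y | x y. x \<in> A \<and> y \<in> B}"

definition ideal_inverse :: "'a::idom fract set \<Rightarrow> 'a fract set" where
  "ideal_inverse A = {x. dilate x A \<subseteq> base_ring}"

definition v_closure :: "'a::idom fract set \<Rightarrow> 'a fract set" where
  "v_closure A = ideal_inverse (ideal_inverse A)"

definition t_closure :: "'a::idom fract set \<Rightarrow> 'a fract set" where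
  "t_closure A =
     \<Union> {v_closure I | I. I \<subseteq> A \<and> nonzero_fractional_ideal I \<and> finitely_generated I}"

definition t_ideal :: "'a::idom fract set \<Rightarrow> bool" where
  "t_ideal A \<longleftrightarrow> nonzero_fractional_ideal A \<and> t_closure A = A"

definition t_finite :: "'a::idom fract set \<Rightarrow> bool" where
  "t_finite I \<longleftrightarrow> t_ideal I \<and>
     (\<exists>J. nonzero_fractional_ideal J \<and> finitely_generated J \<and> I = t_closure J)"

definition t_invertible :: "'a::idom fract set \<Rightarrow> bool" where
  "t_invertible A \<longleftrightarrow> nonzero_fractional_ideal A \<and>
     t_closure (ideal_prod A (ideal_inverse A)) = base_ring"


subsection \<open>The \<open>t\<close>-class group\<close>

definition t_ideal_group :: "'a::idom itself \<Rightarrow> 'a fract set monoid" where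
  "t_ideal_group TYPE('a) =
     \<lparr>carrier = {I. t_ideal I \<and> t_invertible I},
      mult = (\<lambda>I J. t_closure (ideal_prod I J)),
      one = base_ring\<rparr>"

definition principal_ideals :: "'a::idom itself \<Rightarrow> 'a fract set set" where
  "principal_ideals TYPE('a) = {dilate x base_ring | x. x \<noteq> 0}"

definition t_class_group :: "'a::idom itself \<Rightarrow> 'a fract set set monoid" where
  "t_class_group TYPE('a) = t_ideal_group TYPE('a) Mod principal_ideals TYPE('a)"


subsection \<open>Finite conductor condition and GCD-domains\<close>

definition t_finite_conductor :: "'a::idom itself \<Rightarrow> bool" where
  "t_finite_conductor TYPE('a) \<longleftrightarrow>
     (\<forall>a b::'a. a \<noteq> 0 \<and> b \<noteq> 0 \<longrightarrow>
        t_finite (dilate (to_fract a) base_ring \<inter> dilate (to_fract b) base_ring))"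

text \<open>
  The classes \<^class>\<open>gcd\<close> and its subclasses fix a gcd operation and a normalization as part of
  the type; a GCD-domain is only required to possess greatest common divisors.
\<close>

definition GCD_domain :: "'a::idom itself \<Rightarrow> bool" where
  "GCD_domain TYPE('a) \<longleftrightarrow>
     (\<forall>a b::'a. \<exists>g. g dvd a \<and> g dvd b \<and> (\<forall>c. c dvd a \<and> c dvd b \<longrightarrow> c dvd g))"

end

theory Submission
  imports Defs
begin

text \<open>
  An element \<open>a\<close> is primal if \<open>a dvd b * c\<close> always lets \<open>a\<close> be split as \<open>a = r * s\<close> with \<open>r dvd b\<close>
  and \<open>s dvd c\<close>. All three claims follow from the fact that every element of a VFD is primal
  (lemma \<open>VFD_primal\<close>), that is, that a VFD is a pre-Schreier domain.

  The reason for primality lies in the elements \<open>s\<close> of \<open>D\<close> with \<open>sV \<inter> D = sD\<close>, for a fixed valuation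
  overring \<open>V\<close>. They are closed under products and under divisors, and they form a chain under
  divisibility because the principal ideals of \<open>V\<close> do. So if \<open>e\<close> is a valuation element, then a
  divisor of any power of \<open>e\<close> is comparable with \<open>e\<close>. On the other hand, a valuation element \<open>a\<close>
  that divides \<open>x * y\<close> divides \<open>x\<^sup>2\<close> or \<open>y\<^sup>2\<close>, namely the square of the factor with the larger value in
  \<open>V\<close>. Hence a valuation element \<open>a\<close> dividing a product of valuation elements divides a power of one
  of them, say \<open>e\<close>, and is therefore comparable with \<open>e\<close>. Cancelling the one that divides the other
  from both and repeating the argument distributes \<open>a\<close> over the factors of the product. In a VFD
  every product \<open>b * c\<close> of nonzero elements is, up to a unit, a product of valuation elements, so
  valuation elements are primal, and products of primal elements are primal.

  A primal atom is prime at once. For the other two claims, primality is used as an interpolation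
  property of divisibility among the nonzero elements of the quotient field \<open>K\<close> (lemma
  \<open>interpolation\<close>): if \<open>X\<close> and \<open>Y\<close> are finite and nonempty and every element of \<open>X\<close> divides every
  element of \<open>Y\<close>, then some \<open>z\<close> lies between them, being divisible by \<open>X\<close> and dividing \<open>Y\<close>.
  If \<open>aD \<inter> bD\<close> is \<open>J\<^sub>t\<close> with \<open>J\<close> finitely generated, an element between \<open>{a, b}\<close> and the generators
  of \<open>J\<close> is a least common multiple of \<open>a\<close> and \<open>b\<close>. If \<open>I\<close> is a \<open>t\<close>-invertible \<open>t\<close>-ideal, finitely
  many elements of \<open>I\<close> and of its inverse suffice to witness the invertibility, and an element
  between the inverses of the latter and the former generates \<open>I\<close>.
\<close>

section \<open>Elements contracted from a valuation overring\<close>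

text \<open>
  For nonzero \<open>s\<close> this is the condition \<open>sV \<inter> D = sD\<close>, written in terms of divisibility. Units of \<open>D\<close>
  are admitted, so that products and divisors stay in the class.
\<close>
definition contracted_from :: "'a::idom fract set \<Rightarrow> 'a \<Rightarrow> bool" where
  "contracted_from V s \<longleftrightarrow> s \<noteq> 0 \<and> (\<forall>x. to_fract x / to_fract s \<in> V \<longrightarrow> s dvd x)"

lemma overring_to_fract: "overring V \<Longrightarrow> to_fract x \<in> V"
  by (auto simp: overring_def)

lemma overring_mult: "overring V \<Longrightarrow> x \<in> V \<Longrightarrow> y \<in> V \<Longrightarrow> x * y \<in> V"
  by (auto simp: overring_def)

lemma valuation_overring_divide:
  assumes "valuation_overring V" "x \<noteq> 0" "y \<noteq> 0"
  shows "x / y \<in> V \<or> y / x \<in> V"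
  using assms by (auto simp: valuation_overring_def dest!: spec[of _ "x / y"])

lemma valuation_element_imp_contracted_from:
  assumes "valuation_element a"
  obtains V where "valuation_overring V" "contracted_from V a"
proof -
  obtain V where V: "valuation_overring V"
    "dilate (to_fract a) V \<inter> base_ring = dilate (to_fract a) base_ring" and a: "a \<noteq> 0"
    using assms by (auto simp: valuation_element_def)
  have "a dvd x" if "to_fract x / to_fract a \<in> V" for x
  proof -
    have "to_fract x = to_fract a * (to_fract x / to_fract a)"
      using a by simp
    then have "to_fract x \<in> dilate (to_fract a) V \<inter> base_ring"
      using that unfolding dilate_def by blast
    then obtain c where "to_fract x = to_fract a * to_fract c"
      using V(2) by (auto simp: dilate_def)
    then have "to_fract x = to_fract (a * c)" by simp
    then show ?thesis by (simp only: to_fract_eq_iff dvd_triv_left)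
  qed
  then show ?thesis using that V a by (auto simp: contracted_from_def)
qed

text \<open>
  The two factors are cancelled one after the other: \<open>stV \<subseteq> sV\<close> allows \<open>s\<close> to be divided out in
  \<open>D\<close>, and the quotient then lies in \<open>tV\<close>.
\<close>
lemma contracted_from_mult:
  assumes V: "overring V" and s: "contracted_from V s" and t: "contracted_from V t"
  shows "contracted_from V (s * t)"
  unfolding contracted_from_def
proof (intro conjI allI impI)
  show "s * t \<noteq> 0" using s t by (auto simp: contracted_from_def)
next
  fix x assume x: "to_fract x / to_fract (s * t) \<in> V"
  have nz: "s \<noteq> 0" "t \<noteq> 0" using s t by (auto simp: contracted_from_def)
  have "to_fract x / to_fract s = to_fract t * (to_fract x / to_fract (s * t))"
    using nz by simp
  then have "to_fract x / to_fract s \<in> V"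
    by (simp only: overring_mult[OF V overring_to_fract[OF V] x])
  then obtain y where y: "x = s * y" using s by (auto simp: contracted_from_def elim: dvdE)
  have "to_fract y / to_fract t \<in> V" using x nz by (simp add: y)
  then show "s * t dvd x" using t y by (auto simp: contracted_from_def)
qed

lemma contracted_from_power:
  assumes "overring V" "contracted_from V s"
  shows "contracted_from V (s ^ n)"
proof (induction n)
  case 0
  show ?case by (simp add: contracted_from_def)
qed (use assms contracted_from_mult in auto)

lemma contracted_from_dvd:
  assumes s: "contracted_from V s" and "r dvd s"
  shows "contracted_from V r"
proof -
  obtain t where t: "s = r * t" using assms by auto
  then have nz: "r \<noteq> 0" "t \<noteq> 0" using s by (auto simp: contracted_from_def)
  have "r dvd x" if "to_fract x / to_fract r \<in> V" for x
  proof -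
    have "to_fract (x * t) / to_fract s = to_fract x / to_fract r" using nz by (simp add: t)
    then have "r * t dvd x * t" using s t that unfolding contracted_from_def by metis
    then show ?thesis using nz by simp
  qed
  then show ?thesis using nz by (auto simp: contracted_from_def)
qed

lemma contracted_from_linear:
  assumes V: "valuation_overring V" and s: "contracted_from V s" and t: "contracted_from V t"
  shows "s dvd t \<or> t dvd s"
proof -
  have "s \<noteq> 0" "t \<noteq> 0" using s t by (auto simp: contracted_from_def)
  then have "to_fract t / to_fract s \<in> V \<or> to_fract s / to_fract t \<in> V"
    by (intro valuation_overring_divide[OF V]) auto
  then show ?thesis using s t by (auto simp: contracted_from_def)
qed

text \<open>
  For a nonunit \<open>a\<close> this makes the radical of \<open>aD\<close> a prime ideal. If \<open>x\<close> has at least the value of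
  \<open>y\<close> in \<open>V\<close>, then \<open>x\<^sup>2\<close> is a multiple of \<open>x * y\<close>, and hence of \<open>a\<close>, in \<open>V\<close>.
\<close>
lemma contracted_from_dvd_mult:
  assumes V: "valuation_overring V" and a: "contracted_from V a" and "a dvd x * y"
  shows "a dvd x\<^sup>2 \<or> a dvd y\<^sup>2"
proof -
  have O: "overring V" using V by (simp add: valuation_overring_def)
  obtain q where q: "x * y = a * q" using assms by auto
  have nz: "a \<noteq> 0" using a by (auto simp: contracted_from_def)
  have step: "a dvd u\<^sup>2" if uv: "u * v = a * q" "v \<noteq> 0" "to_fract u / to_fract v \<in> V" for u v
  proof -
    have "a * (q * u) = u\<^sup>2 * v" using uv(1) by (simp add: power2_eq_square ac_simps)
    then have "to_fract a * (to_fract q * to_fract u) = to_fract (u\<^sup>2) * to_fract v"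
      by (simp only: to_fract_mult[symmetric])
    then have "to_fract (u\<^sup>2) / to_fract a = to_fract q * (to_fract u / to_fract v)"
      using frac_eq_eq[of "to_fract a" "to_fract v" "to_fract (u\<^sup>2)" "to_fract q * to_fract u"]
        nz uv(2)
      by (simp only: to_fract_eq_0_iff mult.commute times_divide_eq_right simp_thms)
    also have "\<dots> \<in> V" by (rule overring_mult[OF O overring_to_fract[OF O] uv(3)])
    finally show ?thesis using a by (auto simp: contracted_from_def)
  qed
  show ?thesis
  proof (cases "x = 0 \<or> y = 0")
    case False
    then have "to_fract x / to_fract y \<in> V \<or> to_fract y / to_fract x \<in> V"
      by (intro valuation_overring_divide[OF V]) auto
    then show ?thesis using step[of x y] step[of y x] False q by (auto simp: mult.commute)
  qed auto
qed

text \<open>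
  The exponent \<open>k\<close> makes the induction work, because every factor that is split off doubles it.
\<close>
lemma contracted_from_dvd_prod_list_power:
  assumes V: "valuation_overring V" and a: "contracted_from V a" and nu: "\<not> a dvd 1"
    and "a dvd prod_list es ^ k"
  shows "\<exists>e\<in>set es. \<exists>n. a dvd e ^ n"
  using assms(4)
proof (induction es arbitrary: k)
  case Nil
  then show ?case using nu by simp
next
  case (Cons e es)
  have "a dvd e ^ k * prod_list es ^ k" using Cons.prems by (simp add: power_mult_distrib)
  from contracted_from_dvd_mult[OF V a this]
  have "a dvd e ^ (k * 2) \<or> a dvd prod_list es ^ (k * 2)" by (simp add: power_mult)
  then show ?case using Cons.IH[of "k * 2"] by auto
qed

text \<open>
  A divisor of a power of \<open>e\<close> is contracted from the valuation overring of \<open>e\<close>, whatever other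
  valuation overrings belong to it. This is the bridge between different valuation overrings.
\<close>
lemma valuation_element_dvd_power_linear:
  assumes "valuation_element e" "a dvd e ^ n"
  shows "a dvd e \<or> e dvd a"
proof -
  obtain W where W: "valuation_overring W" "contracted_from W e"
    using assms valuation_element_imp_contracted_from by blast
  then have "contracted_from W a"
    using assms(2) contracted_from_power contracted_from_dvd
    by (metis valuation_overring_def)
  then show ?thesis using contracted_from_linear W by blast
qed


section \<open>Primality of all elements\<close>

definition primal :: "'a::idom \<Rightarrow> bool" where
  "primal a \<longleftrightarrow> (\<forall>b c. a dvd b * c \<longrightarrow> (\<exists>r s. a = r * s \<and> r dvd b \<and> s dvd c))"

text \<open>
  Each step picks a factor \<open>e\<close> of which \<open>a\<close> divides a power. As \<open>a\<close> and \<open>e\<close> are comparable,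
  the one that divides the other is a common divisor \<open>g\<close>, and \<open>a / g\<close> divides the product of the remaining
  factors: either \<open>a / g = 1\<close>, or \<open>g = e\<close> is cancelled on both sides. The unit \<open>u\<close> takes care of
  the empty product.
\<close>
lemma contracted_from_dvd_prod_list_split:
  assumes V: "valuation_overring V" and "contracted_from V a"
    and "\<forall>e\<in>set es. valuation_element e" and "a dvd prod_list es"
  shows "\<exists>u rs. a = u * prod_list rs \<and> u dvd 1 \<and> list_all2 (dvd) rs es"
  using assms(2-)
proof (induction "length es" arbitrary: es a)
  case 0
  then have "a = a * prod_list [] \<and> a dvd 1 \<and> list_all2 (dvd) [] es" by simp
  then show ?case by blast
next
  case (Suc n)
  show ?case
  proof (cases "a dvd 1")
    case True
    have "list_all2 (dvd) (replicate (length es) 1) es"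
      by (simp add: list_all2_conv_all_nth)
    then have "a = a * prod_list (replicate (length es) 1) \<and> a dvd 1 \<and>
        list_all2 (dvd) (replicate (length es) 1) es"
      using True by simp
    then show ?thesis by blast
  next
    case False
    obtain e m where e: "e \<in> set es" "a dvd e ^ m"
      using contracted_from_dvd_prod_list_power[OF V Suc.prems(1) False, of es 1] Suc.prems(3)
      by auto
    obtain us ws where es: "es = us @ e # ws" using e(1) by (meson split_list)
    have nz: "e \<noteq> 0" using e(1) Suc.prems(2) by (auto simp: valuation_element_def)
    have rest: "prod_list es = e * prod_list (us @ ws)" by (simp add: es ac_simps)
    have "\<exists>g a'. a = g * a' \<and> g dvd e \<and> a' dvd prod_list (us @ ws)"
    proof (cases "a dvd e")
      case True
      then have "a = a * 1 \<and> a dvd e \<and> 1 dvd prod_list (us @ ws)" by simp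
      then show ?thesis by blast
    next
      case False
      then have "e dvd a"
        using valuation_element_dvd_power_linear[OF _ e(2)] e(1) Suc.prems(2) by blast
      then obtain a' where a': "a = e * a'" by auto
      then have "a' dvd prod_list (us @ ws)" using Suc.prems(3) rest nz by simp
      with a' have "a = e * a' \<and> e dvd e \<and> a' dvd prod_list (us @ ws)" by simp
      then show ?thesis by blast
    qed
    then obtain g a' where g: "a = g * a'" "g dvd e" "a' dvd prod_list (us @ ws)" by blast
    have "contracted_from V a'"
      using contracted_from_dvd[OF Suc.prems(1), of a'] g(1) by simp
    then obtain u rs where u: "a' = u * prod_list rs" "u dvd 1" "list_all2 (dvd) rs (us @ ws)"
      using Suc.hyps(1)[of "us @ ws" a'] Suc.hyps(2) Suc.prems(2) g(3) es by auto
    then obtain ps qs where rs: "rs = ps @ qs" "list_all2 (dvd) ps us" "list_all2 (dvd) qs ws"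
      by (auto simp: list_all2_append2)
    have "a = u * prod_list (ps @ g # qs) \<and> u dvd 1 \<and> list_all2 (dvd) (ps @ g # qs) es"
      using g u rs es by (auto simp: ac_simps intro!: list_all2_appendI)
    then show ?thesis by blast
  qed
qed

lemma list_all2_dvd_prod_list:
  fixes rs es :: "'a::comm_monoid_mult list"
  shows "list_all2 (dvd) rs es \<Longrightarrow> prod_list rs dvd prod_list es"
  by (induction rule: list_all2_induct) (auto intro: mult_dvd_mono)

lemma primal_mult:
  assumes "primal a" "primal b"
  shows "primal (a * b)"
  unfolding primal_def
proof (intro allI impI)
  fix x y assume ab: "a * b dvd x * y"
  show "\<exists>r s. a * b = r * s \<and> r dvd x \<and> s dvd y"
  proof (cases "a = 0")
    case True
    then have "x = 0 \<or> y = 0" using ab by simp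
    then show ?thesis
    proof
      assume "x = 0"
      then have "a * b = 0 * 1 \<and> 0 dvd x \<and> 1 dvd y" using True by simp
      then show ?thesis by blast
    next
      assume "y = 0"
      then have "a * b = 1 * 0 \<and> 1 dvd x \<and> 0 dvd y" using True by simp
      then show ?thesis by blast
    qed
  next
    case False
    have "a dvd x * y" using ab dvd_mult_left by blast
    then obtain r s where rs: "a = r * s" "r dvd x" "s dvd y"
      using assms(1) unfolding primal_def by blast
    then obtain x' y' where x': "x = r * x'" "y = s * y'" by (auto elim!: dvdE)
    have "a * b dvd a * (x' * y')" using ab x' rs by (simp add: ac_simps)
    then have "b dvd x' * y'" using False by simp
    then obtain r' s' where "b = r' * s'" "r' dvd x'" "s' dvd y'"
      using assms(2) unfolding primal_def by blast
    then have "a * b = (r * r') * (s * s') \<and> r * r' dvd x \<and> s * s' dvd y"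
      using rs x' by (simp add: ac_simps mult_dvd_mono)
    then show ?thesis by blast
  qed
qed

lemma unit_mult_dvd:
  fixes u :: "'a::comm_monoid_mult"
  shows "u dvd 1 \<Longrightarrow> x dvd y \<Longrightarrow> u * x dvd y"
  using mult_dvd_mono[of u 1 x y] by simp

lemma primal_unit:
  assumes "(a::'a::idom) dvd 1"
  shows "primal a"
  unfolding primal_def
proof (intro allI impI)
  fix b c :: 'a
  have "a = a * 1 \<and> a dvd b \<and> 1 dvd c" using dvd_trans[OF assms, of b] by simp
  then show "\<exists>r s. a = r * s \<and> r dvd b \<and> s dvd c" by blast
qed

lemma primal_zero: "primal 0"
proof -
  have "\<exists>r s. 0 = r * s \<and> r dvd b \<and> s dvd c" if "b * c = 0" for b c :: 'a
  proof -
    have "0 = b * c \<and> b dvd b \<and> c dvd c" using that by simp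
    then show ?thesis by blast
  qed
  then show ?thesis by (simp add: primal_def)
qed

lemma VFD_factorization:
  assumes "VFD TYPE('a::idom)" and "(b::'a) \<noteq> 0"
  obtains u es where "b = u * prod_list es" "u dvd 1" "\<forall>e\<in>set es. valuation_element e"
proof (cases "b dvd 1")
  case True
  then show ?thesis using that[of b "[]"] by simp
next
  case False
  then obtain es where "b = prod_list es" "\<forall>e\<in>set es. valuation_element e"
    using assms unfolding VFD_def by blast
  then show ?thesis using that[of 1 es] by simp
qed

lemma VFD_valuation_element_primal:
  assumes D: "VFD TYPE('a::idom)" and a: "valuation_element (a::'a)"
  shows "primal a"
  unfolding primal_def
proof (intro allI impI)
  fix b c assume dvd: "a dvd b * c"
  show "\<exists>r s. a = r * s \<and> r dvd b \<and> s dvd c"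
  proof (cases "b = 0 \<or> c = 0")
    case True
    then have "(a = a * 1 \<and> a dvd b \<and> 1 dvd c) \<or> (a = 1 * a \<and> 1 dvd b \<and> a dvd c)" by auto
    then show ?thesis by blast
  next
    case False
    obtain u es where b: "b = u * prod_list es" "u dvd 1" "\<forall>e\<in>set es. valuation_element e"
      using VFD_factorization[OF D, of b] False by blast
    obtain v fs where c: "c = v * prod_list fs" "v dvd 1" "\<forall>e\<in>set fs. valuation_element e"
      using VFD_factorization[OF D, of c] False by blast
    have "b * c = (u * v) * prod_list (es @ fs)" by (simp add: b(1) c(1) ac_simps)
    moreover have "u * v dvd 1" using mult_dvd_mono[OF b(2) c(2)] by simp
    ultimately have "b * c dvd prod_list (es @ fs)" by (simp only: unit_mult_dvd[OF _ dvd_refl])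
    with dvd have "a dvd prod_list (es @ fs)" by (rule dvd_trans)
    moreover obtain V where "valuation_overring V" "contracted_from V a"
      using a valuation_element_imp_contracted_from by blast
    ultimately obtain w rs where rs: "a = w * prod_list rs" "w dvd 1"
      "list_all2 (dvd) rs (es @ fs)"
      using contracted_from_dvd_prod_list_split[of V a "es @ fs"] b c by auto
    obtain ps qs where pq: "rs = ps @ qs" "list_all2 (dvd) ps es" "list_all2 (dvd) qs fs"
      using rs(3) by (auto simp: list_all2_append2)
    have "w * prod_list ps dvd b"
      using unit_mult_dvd[OF rs(2) list_all2_dvd_prod_list[OF pq(2)]] by (simp add: b(1))
    moreover have "prod_list qs dvd c"
      using list_all2_dvd_prod_list[OF pq(3)] c by simp
    ultimately have "a = (w * prod_list ps) * prod_list qs \<and> w * prod_list ps dvd b \<and>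
        prod_list qs dvd c"
      using rs pq by (simp add: ac_simps)
    then show ?thesis by blast
  qed
qed

theorem VFD_primal:
  assumes D: "VFD TYPE('a::idom)"
  shows "primal (a::'a)"
proof (cases "a = 0")
  case True
  then show ?thesis by (simp add: primal_zero)
next
  case False
  obtain u es where a: "a = u * prod_list es" "u dvd 1" "\<forall>e\<in>set es. valuation_element e"
    using VFD_factorization[OF D False] by blast
  have "primal (prod_list es)" using a(3)
  proof (induction es)
    case Nil
    show ?case by (simp add: primal_unit)
  next
    case (Cons e es)
    then show ?case using primal_mult VFD_valuation_element_primal[OF D, of e] by auto
  qed
  then show ?thesis using a by (simp add: primal_mult primal_unit)
qed

lemma irreducible_primal_imp_prime_elem:
  assumes p: "irreducible p" and primal: "primal p"
  shows "prime_elem p"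
proof (rule prime_elemI)
  show "p \<noteq> 0" "\<not> p dvd 1" using p by (auto simp: irreducible_def)
next
  fix b c assume "p dvd b * c"
  then obtain r s where rs: "p = r * s" "r dvd b" "s dvd c"
    using primal unfolding primal_def by blast
  then have "r dvd 1 \<or> s dvd 1" using p by (auto simp: irreducible_def)
  then show "p dvd b \<or> p dvd c"
  proof
    assume "r dvd 1"
    then show ?thesis using unit_mult_dvd[OF _ rs(3)] rs(1) by simp
  next
    assume "s dvd 1"
    then show ?thesis using unit_mult_dvd[OF _ rs(2), of s] rs(1) by (simp add: mult.commute)
  qed
qed


section \<open>Interpolation in the quotient field\<close>

text \<open>
  Divisibility of \<open>y\<close> by \<open>x\<close> in \<open>K\<close>, with cofactor in \<open>D\<close>, is expressed by \<open>y \<in> principal x\<close>.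
\<close>
abbreviation principal :: "'a::idom fract \<Rightarrow> 'a fract set" where
  "principal x \<equiv> dilate x base_ring"

lemma mem_principal_iff: "y \<in> principal x \<longleftrightarrow> (\<exists>c. y = x * to_fract c)"
  by (auto simp: dilate_def)

lemma base_ring_mult: "x \<in> base_ring \<Longrightarrow> y \<in> base_ring \<Longrightarrow> x * y \<in> base_ring"
  by (auto simp flip: to_fract_mult)

lemma mem_principal_iff_divide: "x \<noteq> 0 \<Longrightarrow> y \<in> principal x \<longleftrightarrow> y / x \<in> base_ring"
  by (auto simp: mem_principal_iff field_simps)

lemma to_fract_mem_principal_iff:
  "to_fract b \<in> principal (to_fract a) \<longleftrightarrow> a dvd b"
proof -
  have "to_fract b = to_fract a * to_fract c \<longleftrightarrow> b = a * c" for c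
    by (metis to_fract_eq_iff to_fract_mult)
  then show ?thesis by (simp add: mem_principal_iff dvd_def)
qed

lemma principal_trans: "z \<in> principal y \<Longrightarrow> y \<in> principal x \<Longrightarrow> z \<in> principal x"
  by (auto simp: mem_principal_iff) (metis mult.assoc to_fract_mult)

text \<open>
  Let \<open>u, u'\<close> be the cofactors of \<open>x1\<close> in \<open>y1, y2\<close>, and \<open>w, w'\<close> those of \<open>x2\<close>. Then
  \<open>u * w' = u' * w\<close>, and primality of \<open>u\<close> refines this to \<open>u = k * g\<close>, \<open>u' = k * h\<close>, \<open>w = l * g\<close>,
  \<open>w' = l * h\<close>. The interpolating element is \<open>x1 * k = x2 * l\<close>, with cofactors \<open>g\<close> in \<open>y1\<close> and \<open>h\<close> in
  \<open>y2\<close>.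
\<close>
lemma interpolation_two_two:
  fixes x1 x2 y1 y2 :: "'a::idom fract"
  assumes primal: "\<And>a::'a. primal a" and nz: "y1 \<noteq> 0"
    and le: "y1 \<in> principal x1" "y1 \<in> principal x2" "y2 \<in> principal x1" "y2 \<in> principal x2"
  shows "\<exists>z. z \<in> principal x1 \<and> z \<in> principal x2 \<and> y1 \<in> principal z \<and> y2 \<in> principal z"
proof -
  obtain u w u' w' where eq: "y1 = x1 * to_fract u" "y1 = x2 * to_fract w"
      "y2 = x1 * to_fract u'" "y2 = x2 * to_fract w'"
    using le unfolding mem_principal_iff by metis
  have nz': "x1 \<noteq> 0" "x2 \<noteq> 0" "u \<noteq> 0" "w \<noteq> 0" using eq nz by auto
  have "x1 * x2 * to_fract (u * w') = y1 * y2" using eq(1,4) by (simp add: ac_simps)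
  also have "\<dots> = x1 * x2 * to_fract (u' * w)" using eq(2,3) by (simp add: ac_simps)
  finally have cross: "u * w' = u' * w" using nz' by (simp del: to_fract_mult)
  then have "u dvd u' * w" by (metis dvd_triv_left)
  then obtain k g where kg: "u = k * g" "k dvd u'" "g dvd w"
    using primal[of u] unfolding primal_def by blast
  then obtain h l where hl: "u' = k * h" "w = g * l" by (auto elim!: dvdE)
  have kg': "g \<noteq> 0" "k \<noteq> 0" using nz' kg by auto
  then have w': "w' = h * l" using cross kg hl by (simp add: ac_simps)
  have "y1 = x1 * to_fract k * to_fract g" using eq(1) by (simp add: kg(1) mult.assoc)
  moreover have "y1 = x2 * to_fract l * to_fract g" using eq(2) by (simp add: hl(2) ac_simps)
  ultimately have zg: "x1 * to_fract k * to_fract g = x2 * to_fract l * to_fract g"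
    by (simp only:)
  have z: "x1 * to_fract k = x2 * to_fract l"
    by (rule mult_right_cancel[THEN iffD1, OF _ zg]) (use kg' in simp)
  have "y1 = x1 * to_fract k * to_fract g" "y2 = x1 * to_fract k * to_fract h"
    using eq kg hl by (simp_all add: ac_simps)
  then show ?thesis using z unfolding mem_principal_iff by blast
qed

lemma interpolation_two:
  fixes x1 x2 :: "'a::idom fract"
  assumes primal: "\<And>a::'a. primal a" and "finite Y" "Y \<noteq> {}"
    and "0 \<notin> Y" "\<forall>y\<in>Y. y \<in> principal x1 \<and> y \<in> principal x2"
  shows "\<exists>z. z \<in> principal x1 \<and> z \<in> principal x2 \<and> (\<forall>y\<in>Y. y \<in> principal z)"
  using assms(2-)
proof (induction rule: finite_ne_induct)
  case (singleton y)
  have "y \<in> principal y" by (metis mem_principal_iff mult_1_right to_fract_1)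
  then show ?case using singleton by blast
next
  case (insert y Y)
  then obtain z where z: "z \<in> principal x1" "z \<in> principal x2" "\<forall>y\<in>Y. y \<in> principal z"
    by auto
  obtain z' where "z' \<in> principal x1" "z' \<in> principal x2" "y \<in> principal z'" "z \<in> principal z'"
    using interpolation_two_two[OF primal, of y x1 x2 z] insert.prems z by auto
  then show ?case using z(3) principal_trans by blast
qed

lemma interpolation:
  fixes X Y :: "'a::idom fract set"
  assumes primal: "\<And>a::'a. primal a" and Y: "finite Y" "Y \<noteq> {}" "0 \<notin> Y"
    and "finite X" "X \<noteq> {}" "\<forall>x\<in>X. \<forall>y\<in>Y. y \<in> principal x"
  shows "\<exists>z. (\<forall>x\<in>X. z \<in> principal x) \<and> (\<forall>y\<in>Y. y \<in> principal z)"
  using assms(5-)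
proof (induction rule: finite_ne_induct)
  case (singleton x)
  have "x \<in> principal x" by (metis mem_principal_iff mult_1_right to_fract_1)
  then show ?case using singleton by blast
next
  case (insert x X)
  then obtain z where z: "\<forall>x\<in>X. z \<in> principal x" "\<forall>y\<in>Y. y \<in> principal z"
    by auto
  obtain z' where "z' \<in> principal x" "z' \<in> principal z" "\<forall>y\<in>Y. y \<in> principal z'"
    using interpolation_two[OF primal Y, of x z] insert.prems z by auto
  then show ?case using z principal_trans by blast
qed


section \<open>Closures of fractional ideals\<close>

lemma mem_ideal_inverse_iff: "x \<in> ideal_inverse A \<longleftrightarrow> (\<forall>y\<in>A. x * y \<in> base_ring)"
  by (auto simp: ideal_inverse_def dilate_def)

lemma mem_v_closure_iff:
  "x \<in> v_closure A \<longleftrightarrow> (\<forall>u. (\<forall>y\<in>A. u * y \<in> base_ring) \<longrightarrow> x * u \<in> base_ring)"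
  by (auto simp: v_closure_def mem_ideal_inverse_iff)

lemma subspace_principal: "frac.subspace (principal x)"
  unfolding frac.subspace_def
proof (intro conjI ballI allI)
  show "0 \<in> principal x" by (auto simp: mem_principal_iff intro: exI[of _ 0])
next
  fix a b assume "a \<in> principal x" "b \<in> principal x"
  then show "a + b \<in> principal x"
    by (auto simp: mem_principal_iff simp flip: to_fract_add distrib_left)
next
  fix c a assume "a \<in> principal x"
  then show "to_fract c * a \<in> principal x"
    by (auto simp: mem_principal_iff) (metis mult.left_commute to_fract_mult)
qed

lemma ideal_inverse_span: "ideal_inverse (frac.span S) = ideal_inverse S"
proof
  show "ideal_inverse (frac.span S) \<subseteq> ideal_inverse S"
    unfolding subset_iff mem_ideal_inverse_iff by (blast intro: frac.span_base)
  show "ideal_inverse S \<subseteq> ideal_inverse (frac.span S)"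
  proof
    fix x assume x: "x \<in> ideal_inverse S"
    show "x \<in> ideal_inverse (frac.span S)"
    proof (cases "x = 0")
      case True
      have "(0::'a fract) \<in> base_ring" by (metis rangeI to_fract_0)
      then show ?thesis using True by (simp add: mem_ideal_inverse_iff)
    next
      case False
      have "S \<subseteq> principal (inverse x)"
        using x False
        by (auto simp: mem_ideal_inverse_iff mem_principal_iff_divide divide_inverse mult.commute)
      then have "frac.span S \<subseteq> principal (inverse x)"
        by (rule frac.span_minimal[OF _ subspace_principal])
      then show ?thesis using False
        by (auto simp: mem_ideal_inverse_iff mem_principal_iff_divide divide_inverse mult.commute)
    qed
  qed
qed

lemma v_closure_superset: "A \<subseteq> v_closure A"
  unfolding mem_v_closure_iff subset_iff by (metis mult.commute)

lemma v_closure_subset_principal: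
  assumes z: "z \<noteq> 0" and A: "A \<subseteq> principal z"
  shows "v_closure A \<subseteq> principal z"
proof
  fix x assume x: "x \<in> v_closure A"
  have "\<forall>y\<in>A. inverse z * y \<in> base_ring"
    using A z by (auto simp: subset_iff mem_principal_iff_divide divide_inverse mult.commute)
  then have "x * inverse z \<in> base_ring" using x by (simp add: mem_v_closure_iff)
  then show "x \<in> principal z" using z by (simp add: mem_principal_iff_divide divide_inverse)
qed

lemma t_closure_subset_principal:
  assumes "z \<noteq> 0" "A \<subseteq> principal z"
  shows "t_closure A \<subseteq> principal z"
proof
  fix x assume "x \<in> t_closure A"
  then obtain I where "x \<in> v_closure I" "I \<subseteq> A" by (auto simp: t_closure_def)
  then show "x \<in> principal z" using v_closure_subset_principal[of z I] assms by blast
qed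

lemma nonzero_fractional_ideal_span:
  assumes A: "fractional_ideal A" and S: "S \<subseteq> A" "s \<in> S" "s \<noteq> 0"
  shows "nonzero_fractional_ideal (frac.span S)" "frac.span S \<subseteq> A"
proof -
  show sub: "frac.span S \<subseteq> A"
    using A S by (intro frac.span_minimal) (auto simp: fractional_ideal_def)
  then have "fractional_ideal (frac.span S)"
    using A unfolding fractional_ideal_def dilate_def by blast
  moreover have "s \<in> frac.span S" using S by (simp add: frac.span_base)
  ultimately show "nonzero_fractional_ideal (frac.span S)"
    using S by (auto simp: nonzero_fractional_ideal_def)
qed

lemma v_closure_span_subset_t_closure:
  assumes "fractional_ideal A" "finite S" "S \<subseteq> A" "s \<in> S" "s \<noteq> 0"
  shows "v_closure (frac.span S) \<subseteq> t_closure A"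
  using nonzero_fractional_ideal_span[OF assms(1,3-5)] assms(2)
  unfolding t_closure_def finitely_generated_def by blast

lemma nonzero_fractional_ideal_obtain:
  assumes "nonzero_fractional_ideal A"
  obtains a where "a \<in> A" "a \<noteq> 0"
  using assms frac.subspace_0[of A]
  by (auto simp: nonzero_fractional_ideal_def fractional_ideal_def)

lemma t_closure_superset:
  assumes A: "nonzero_fractional_ideal A"
  shows "A \<subseteq> t_closure A"
proof
  fix x assume x: "x \<in> A"
  obtain a where a: "a \<in> A" "a \<noteq> 0" using nonzero_fractional_ideal_obtain[OF A] .
  have "x \<in> v_closure (frac.span {x, a})"
    by (intro subsetD[OF v_closure_superset] frac.span_base) simp
  then show "x \<in> t_closure A"
    using v_closure_span_subset_t_closure[of A "{x, a}" a] A x a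
    by (auto simp: nonzero_fractional_ideal_def)
qed

lemma nonzero_fractional_ideal_principal:
  assumes "x \<noteq> 0"
  shows "nonzero_fractional_ideal (principal x)"
proof -
  obtain a d where x: "x = to_fract a / to_fract d" "d \<noteq> 0"
    by (cases x) (auto simp: Fract_conv_to_fract)
  have "to_fract d * (x * to_fract c) = to_fract (a * c)" for c
    using x by simp
  then have "dilate (to_fract d) (principal x) \<subseteq> base_ring"
    unfolding dilate_def by blast
  moreover have "x \<in> principal x" by (metis mem_principal_iff mult_1_right to_fract_1)
  ultimately show ?thesis using x assms subspace_principal
    by (auto simp: nonzero_fractional_ideal_def fractional_ideal_def)
qed

lemma t_closure_principal: "x \<noteq> 0 \<Longrightarrow> t_closure (principal x) = principal x"
  by (simp add: equalityI nonzero_fractional_ideal_principal t_closure_subset_principal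
      t_closure_superset)

lemma ideal_prod_principal: "ideal_prod (principal x) (principal y) = principal (x * y)"
proof -
  have "{a * b | a b. a \<in> principal x \<and> b \<in> principal y} = principal (x * y)" (is "?P = _")
  proof (intro equalityI subsetI)
    fix z assume "z \<in> ?P"
    then obtain c d where "z = (x * to_fract c) * (y * to_fract d)"
      by (auto simp: mem_principal_iff)
    then have "z = (x * y) * to_fract (c * d)" by (simp add: ac_simps)
    then show "z \<in> principal (x * y)" unfolding mem_principal_iff by blast
  next
    fix z assume "z \<in> principal (x * y)"
    then obtain c where "z = (x * to_fract c) * (y * to_fract 1)"
      by (auto simp: mem_principal_iff ac_simps)
    then show "z \<in> ?P" unfolding mem_principal_iff by blast
  qed
  then show ?thesis
    by (simp add: ideal_prod_def frac.span_eq_iff[THEN iffD2] subspace_principal)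
qed

lemma base_ring_eq_principal: "base_ring = principal 1"
  by (auto simp: dilate_def)

lemma ideal_inverse_base_ring: "ideal_inverse base_ring = base_ring"
proof
  show "ideal_inverse base_ring \<subseteq> (base_ring :: 'a::idom fract set)"
  proof
    fix x :: "'a fract" assume "x \<in> ideal_inverse base_ring"
    then have "x * to_fract 1 \<in> base_ring" unfolding mem_ideal_inverse_iff by blast
    then show "x \<in> base_ring" by simp
  qed
  show "base_ring \<subseteq> ideal_inverse (base_ring :: 'a::idom fract set)"
    by (auto simp: mem_ideal_inverse_iff simp del: to_fract_mult simp flip: to_fract_mult)
qed


section \<open>Consequences for t-ideals\<close>

lemma subset_span_finite_subset:
  assumes "finite S" "S \<subseteq> frac.span P"
  shows "\<exists>T. finite T \<and> T \<subseteq> P \<and> S \<subseteq> frac.span T"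
  using assms
proof (induction S)
  case (insert x S)
  then obtain T where T: "finite T" "T \<subseteq> P" "S \<subseteq> frac.span T" by auto
  obtain t r where t: "finite t" "t \<subseteq> P" "x = (\<Sum>a\<in>t. to_fract (r a) * a)"
    using insert.prems by (auto simp: frac.span_explicit)
  have "x \<in> frac.span t"
    unfolding t(3) by (intro frac.span_sum frac.span_scale frac.span_base)
  then have "insert x S \<subseteq> frac.span (T \<union> t)"
    using T(3) frac.span_mono[of T "T \<union> t"] frac.span_mono[of t "T \<union> t"] by blast
  then show ?case using T t by (intro exI[of _ "T \<union> t"]) auto
qed auto

text \<open>
  The unit \<open>1\<close> lies in \<open>J\<^sub>v\<close> for a finitely generated \<open>J\<close> inside \<open>I I\<^sup>-\<^sup>1\<close>, and the generators of
  \<open>J\<close> involve only finitely many elements \<open>A\<close> of \<open>I\<close> and \<open>B\<close> of the inverse. The last conclusion says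
  that the ideal generated by the products \<open>a * b\<close> has an inverse contained in \<open>D\<close>.
\<close>
lemma t_invertible_finite_witness:
  assumes "t_invertible I"
  obtains A B where "finite A" "A \<subseteq> I" "finite B" "B \<subseteq> ideal_inverse I"
    and "\<And>x. (\<forall>a\<in>A. \<forall>b\<in>B. x * (a * b) \<in> base_ring) \<Longrightarrow> x \<in> base_ring"
proof -
  let ?P = "{x * y | x y. x \<in> I \<and> y \<in> ideal_inverse I}"
  have "1 \<in> t_closure (ideal_prod I (ideal_inverse I))"
    using assms by (simp add: t_invertible_def) (metis rangeI to_fract_1)
  then obtain S where S: "1 \<in> v_closure (frac.span S)" "finite S" "S \<subseteq> frac.span ?P"
    using frac.span_superset
    by (fastforce simp: t_closure_def finitely_generated_def ideal_prod_def)
  obtain T where T: "finite T" "T \<subseteq> ?P" "S \<subseteq> frac.span T"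
    using subset_span_finite_subset[OF S(2,3)] by blast
  have "?P = (\<lambda>(x, y). x * y) ` (I \<times> ideal_inverse I)" by auto
  then have "T \<subseteq> (\<lambda>(x, y). x * y) ` (I \<times> ideal_inverse I)" using T(2) by (simp only:)
  from finite_subset_image[OF T(1) this]
  obtain C where C: "finite C" "C \<subseteq> I \<times> ideal_inverse I" "T = (\<lambda>(x, y). x * y) ` C"
    by blast
  show thesis
  proof (rule that[of "fst ` C" "snd ` C"])
    fix x assume x: "\<forall>a\<in>fst ` C. \<forall>b\<in>snd ` C. x * (a * b) \<in> base_ring"
    have "\<forall>t\<in>T. x * t \<in> base_ring"
      using x by (force simp: C(3))
    then have "x \<in> ideal_inverse (frac.span T)"
      by (simp add: ideal_inverse_span mem_ideal_inverse_iff)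
    moreover have "frac.span S \<subseteq> frac.span T"
      using T(3) by (simp add: frac.span_minimal)
    ultimately have "\<forall>y\<in>frac.span S. x * y \<in> base_ring"
      by (auto simp: mem_ideal_inverse_iff)
    then have "1 * x \<in> base_ring"
      using S(1) unfolding mem_v_closure_iff by blast
    then show "x \<in> base_ring" by simp
  qed (use C in auto)
qed

text \<open>
  Let \<open>A\<close> and \<open>B\<close> be finite witnesses of invertibility. All products \<open>a * b\<close> lie in \<open>D\<close>, which means
  that the inverses of the nonzero elements of \<open>B\<close> divide the elements of \<open>A\<close>. An interpolating \<open>z\<close> satisfies
  \<open>A \<subseteq> zD\<close> and \<open>zB \<subseteq> D\<close>. For \<open>x\<close> in \<open>I\<close> one has \<open>xB \<subseteq> D\<close>, so \<open>x / z\<close> multiplies every \<open>a * b\<close> into \<open>D\<close>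
  and lies in \<open>D\<close>; conversely, \<open>z\<close> belongs to the \<open>v\<close>-closure of the ideal generated by \<open>A\<close>, and hence
  to \<open>I\<close>.
\<close>
theorem primal_imp_t_invertible_principal:
  fixes I :: "'a::idom fract set"
  assumes primal: "\<And>a::'a. primal a" and I: "t_ideal I" "t_invertible I"
  shows "\<exists>z. z \<noteq> 0 \<and> I = principal z"
proof -
  have frac: "nonzero_fractional_ideal I" and closed: "t_closure I = I"
    using I by (auto simp: t_ideal_def)
  obtain A B where AB: "finite A" "A \<subseteq> I" "finite B" "B \<subseteq> ideal_inverse I"
    and unit: "\<And>x. (\<forall>a\<in>A. \<forall>b\<in>B. x * (a * b) \<in> base_ring) \<Longrightarrow> x \<in> base_ring"
    using t_invertible_finite_witness[OF I(2)] by metis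
  obtain a0 where a0: "a0 \<in> I" "a0 \<noteq> 0" using nonzero_fractional_ideal_obtain[OF frac] .
  obtain d where d: "d \<noteq> 0" "dilate (to_fract d) I \<subseteq> base_ring"
    using frac by (auto simp: nonzero_fractional_ideal_def fractional_ideal_def)
  have d': "to_fract d \<in> ideal_inverse I" using d by (simp add: ideal_inverse_def)
  \<comment> \<open>The nonzero elements \<open>a0\<close> and \<open>d\<close> keep both sets nonempty after the removal of \<open>0\<close>, whose
    inverse is \<open>0\<close> by convention.\<close>
  define Y where "Y = insert a0 A - {0}"
  define X where "X = inverse ` (insert (to_fract d) B - {0})"
  have "\<forall>x\<in>X. \<forall>y\<in>Y. y \<in> principal x"
  proof (intro ballI)
    fix x y assume xy: "x \<in> X" "y \<in> Y"
    then have "inverse x \<in> ideal_inverse I" "y \<in> I" "x \<noteq> 0"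
      using AB a0 d' by (auto simp: X_def Y_def)
    then show "y \<in> principal x"
      by (simp add: mem_principal_iff_divide mem_ideal_inverse_iff divide_inverse mult.commute)
  qed
  moreover have "finite X" "finite Y" "X \<noteq> {}" "Y \<noteq> {}" "0 \<notin> Y"
    using AB a0 d by (auto simp: X_def Y_def)
  ultimately obtain z where z: "\<forall>x\<in>X. z \<in> principal x" "\<forall>y\<in>Y. y \<in> principal z"
    using interpolation[OF primal, of Y X] by blast
  have "a0 \<in> principal z" using z(2) a0 by (simp add: Y_def)
  then have z0: "z \<noteq> 0" using a0 by (auto simp: mem_principal_iff)
  have Az: "a / z \<in> base_ring" if "a \<in> A" for a
  proof (cases "a = 0")
    case True
    then show ?thesis by (metis div_0 rangeI to_fract_0)
  next
    case False
    then show ?thesis using z(2) that z0 by (simp add: Y_def mem_principal_iff_divide)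
  qed
  have Bz: "z * b \<in> base_ring" if "b \<in> B" for b
  proof (cases "b = 0")
    case True
    then show ?thesis by (metis mult_zero_right rangeI to_fract_0)
  next
    case False
    then have "z \<in> principal (inverse b)" using z(1) that by (auto simp: X_def)
    then show ?thesis using False by (simp add: mem_principal_iff_divide divide_inverse)
  qed
  have "I \<subseteq> principal z"
  proof
    fix x assume x: "x \<in> I"
    have "x / z \<in> base_ring"
    proof (rule unit, intro ballI)
      fix a b assume ab: "a \<in> A" "b \<in> B"
      have "b * x \<in> base_ring" using AB ab x by (auto simp: mem_ideal_inverse_iff)
      then have "(b * x) * (a / z) \<in> base_ring" by (rule base_ring_mult[OF _ Az[OF ab(1)]])
      then show "x / z * (a * b) \<in> base_ring" by (simp add: ac_simps)
    qed
    then show "x \<in> principal z" using z0 by (simp add: mem_principal_iff_divide)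
  qed
  moreover have "z \<in> I"
  proof -
    let ?A = "insert a0 A"
    have "z * u \<in> base_ring" if u: "\<forall>y\<in>frac.span ?A. u * y \<in> base_ring" for u
    proof (rule unit, intro ballI)
      fix a b assume ab: "a \<in> A" "b \<in> B"
      have "u * a \<in> base_ring" using u ab by (simp add: frac.span_base)
      then have "(u * a) * (z * b) \<in> base_ring" by (rule base_ring_mult[OF _ Bz[OF ab(2)]])
      then show "z * u * (a * b) \<in> base_ring" by (simp add: ac_simps)
    qed
    then have "z \<in> v_closure (frac.span ?A)" by (simp add: mem_v_closure_iff)
    then show ?thesis
      using v_closure_span_subset_t_closure[of I ?A a0] frac AB a0 closed
      by (auto simp: nonzero_fractional_ideal_def)
  qed
  then have "to_fract c * z \<in> I" for c
    using frac
    by (simp add: frac.subspace_scale nonzero_fractional_ideal_def fractional_ideal_def)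
  then have "principal z \<subseteq> I" by (auto simp: mem_principal_iff mult.commute)
  ultimately show ?thesis using z0 by blast
qed

text \<open>
  Interpolating between \<open>{a, b}\<close> and the generators of \<open>aD \<inter> bD\<close> gives a common multiple \<open>m\<close> of \<open>a\<close>
  and \<open>b\<close> that divides all generators. Since \<open>mD\<close> is a \<open>t\<close>-ideal, it contains \<open>aD \<inter> bD\<close>, so \<open>m\<close> is a
  least common multiple, and \<open>a * b / m\<close> is a greatest common divisor.
\<close>
theorem primal_t_finite_conductor_imp_GCD_domain:
  assumes primal: "\<And>a::'a::idom. primal a" and fc: "t_finite_conductor TYPE('a)"
  shows "GCD_domain TYPE('a)"
  unfolding GCD_domain_def
proof (intro allI)
  fix a b :: 'a
  show "\<exists>g. g dvd a \<and> g dvd b \<and> (\<forall>c. c dvd a \<and> c dvd b \<longrightarrow> c dvd g)"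
  proof (cases "a = 0 \<or> b = 0")
    case True
    then show ?thesis by (auto intro: exI[of _ a] exI[of _ b])
  next
    case False
    let ?I = "principal (to_fract a) \<inter> principal (to_fract b)"
    have "t_finite ?I" using fc False by (simp add: t_finite_conductor_def)
    then obtain S where J: "nonzero_fractional_ideal (frac.span S)" "finite S"
        "?I = t_closure (frac.span S)"
      by (auto simp: t_finite_def finitely_generated_def)
    have "S \<subseteq> ?I" using t_closure_superset[OF J(1)] frac.span_superset[of S] J(3) by blast
    define Y where "Y = S - {0}"
    have "Y \<noteq> {}"
    proof
      assume "Y = {}"
      then have "frac.span S \<subseteq> {0}"
        by (intro frac.span_minimal) (auto simp: Y_def frac.subspace_def)
      then show False using nonzero_fractional_ideal_obtain[OF J(1)] by blast
    qed
    then obtain z where z: "z \<in> principal (to_fract a)" "z \<in> principal (to_fract b)"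
        "\<forall>y\<in>Y. y \<in> principal z"
      using interpolation_two[OF primal, of Y "to_fract a" "to_fract b"] \<open>S \<subseteq> ?I\<close> J(2)
      by (auto simp: Y_def)
    obtain y where "y \<in> Y" using \<open>Y \<noteq> {}\<close> by blast
    then have z0: "z \<noteq> 0" using z(3) by (auto simp: Y_def mem_principal_iff)
    have "S \<subseteq> principal z"
      using z(3) frac.subspace_0[OF subspace_principal] by (auto simp: Y_def)
    then have "frac.span S \<subseteq> principal z" by (rule frac.span_minimal[OF _ subspace_principal])
    then have I: "?I \<subseteq> principal z" using t_closure_subset_principal z0 J(3) by metis
    obtain m where m: "z = to_fract m"
      using z(1) by (auto simp: mem_principal_iff) (metis to_fract_mult)
    have lcm: "a dvd m" "b dvd m" "\<And>n. a dvd n \<Longrightarrow> b dvd n \<Longrightarrow> m dvd n"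
      using z(1,2) I unfolding m by (auto simp: subset_iff simp flip: to_fract_mem_principal_iff)
    have m0: "m \<noteq> 0" using z0 m by auto
    obtain g where g: "a * b = m * g" using lcm(3)[of "a * b"] by auto
    obtain p q where pq: "m = a * p" "m = b * q" using lcm(1,2) unfolding dvd_def by blast
    have "a * b = a * (p * g)" "b * a = b * (q * g)" using g pq by (metis mult.assoc mult.commute)+
    then have "b = p * g" "a = q * g" using False mult_left_cancel by blast+
    moreover have "c dvd g" if c: "c dvd a" "c dvd b" for c
    proof -
      obtain a' b' where ab: "a = c * a'" "b = c * b'" using c by (auto elim!: dvdE)
      have "a dvd c * a' * b'" "b dvd c * a' * b'" unfolding ab by (simp_all add: ac_simps)
      then obtain t where t: "c * a' * b' = m * t" using lcm(3) by blast
      have "m * g = c * (c * a' * b')" unfolding g[symmetric] ab by (simp only: ac_simps)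
      also have "\<dots> = m * (c * t)" unfolding t by (simp only: ac_simps)
      finally show ?thesis using m0 by simp
    qed
    ultimately show ?thesis by (intro exI[of _ g]) auto
  qed
qed

text \<open>
  Every coset has a principal ideal as representative, and translation by a principal ideal permutes
  the principal ideals.
\<close>
lemma t_class_group_trivialI:
  assumes principal: "\<And>I::'a::idom fract set. t_ideal I \<Longrightarrow> t_invertible I \<Longrightarrow>
    \<exists>z. z \<noteq> 0 \<and> I = principal z"
  shows "carrier (t_class_group TYPE('a)) = {\<one>\<^bsub>t_class_group TYPE('a)\<^esub>}"
proof -
  let ?G = "t_ideal_group TYPE('a)" and ?H = "principal_ideals TYPE('a)"
  have mult: "principal x \<otimes>\<^bsub>?G\<^esub> principal y = principal (x * y)" if "x \<noteq> 0" "y \<noteq> 0" for x y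
    using that by (simp add: t_ideal_group_def ideal_prod_principal t_closure_principal)
  have coset: "?H #>\<^bsub>?G\<^esub> principal x = ?H" if x: "x \<noteq> 0" for x
  proof (intro equalityI subsetI)
    fix J assume "J \<in> ?H #>\<^bsub>?G\<^esub> principal x"
    then obtain y where "y \<noteq> 0" "J = principal (y * x)"
      using mult x by (auto simp: r_coset_def principal_ideals_def)
    then show "J \<in> ?H" using x by (auto simp: principal_ideals_def)
  next
    fix J assume "J \<in> ?H"
    then obtain y where y: "y \<noteq> 0" "J = principal y" by (auto simp: principal_ideals_def)
    then have "J = principal (y / x) \<otimes>\<^bsub>?G\<^esub> principal x" using mult[of "y / x" x] x by simp
    moreover have "principal (y / x) \<in> ?H"
      using x y(1) unfolding principal_ideals_def by auto
    ultimately show "J \<in> ?H #>\<^bsub>?G\<^esub> principal x" unfolding r_coset_def by blast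
  qed
  have carrier: "\<exists>x. x \<noteq> 0 \<and> I = principal x" if "I \<in> carrier ?G" for I
    using that principal by (simp add: t_ideal_group_def)
  have "t_ideal (principal 1 :: 'a fract set)"
    by (simp add: t_ideal_def nonzero_fractional_ideal_principal t_closure_principal)
  moreover have "t_invertible (principal 1 :: 'a fract set)"
    using ideal_prod_principal[of "1::'a fract" 1] ideal_inverse_base_ring[where 'a='a]
      nonzero_fractional_ideal_principal[of "1::'a fract"] t_closure_principal[of "1::'a fract"]
    by (simp add: t_invertible_def base_ring_eq_principal[symmetric])
  ultimately have "principal 1 \<in> carrier ?G" by (simp add: t_ideal_group_def)
  moreover have "?H #>\<^bsub>?G\<^esub> I = ?H" if "I \<in> carrier ?G" for I
    using carrier[OF that] coset by blast
  ultimately have "(\<Union>I\<in>carrier ?G. {?H #>\<^bsub>?G\<^esub> I}) = {?H}" by blast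
  then show ?thesis by (simp add: t_class_group_def FactGroup_def RCOSETS_def)
qed

theorem corollary2p3:
  assumes "VFD TYPE('a::idom)"
  shows "carrier (t_class_group TYPE('a)) = {\<one>\<^bsub>t_class_group TYPE('a)\<^esub>} \<and>
    (\<forall>p::'a. irreducible p \<longrightarrow> prime_elem p) \<and>
    (t_finite_conductor TYPE('a) \<longrightarrow> GCD_domain TYPE('a))"
  using t_class_group_trivialI[OF primal_imp_t_invertible_principal[OF VFD_primal[OF assms]]]
    irreducible_primal_imp_prime_elem[OF _ VFD_primal[OF assms]]
    primal_t_finite_conductor_imp_GCD_domain[OF VFD_primal[OF assms]]
  by blast

end
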